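(* Let $n\ge 2$, let $\mathbf a,\mathbf b\in\mathbb R^n$ have strictly positive entries with $\alpha=\sum_{i=1}^n\mathbf a_i$, $\beta=\sum_{j=1}^n\mathbf b_j$, let $C\in\mathbb R^{n\times n}$ have nonnegative entries, and let $\tau>0$. Let $\varepsilon>0$ and $\eta=\varepsilon/U$, where $U$ is defined below. Let $(u^k,v^k)_{k\ge 0}$ be the unbalanced Sinkhorn iterates and $(u^*,v^* )$ the minimizer of the dual function $h$ (both defined below). Then for every $k\ge 0$, $$\Delta_{k+1}\le \Lambda_k,$$ where $\Delta_k=\max\{\|u^k-u^*\|_\infty,\|v^k-v^*\|_\infty\}$ and $\Lambda_k=\tau\left(\frac{\tau}{\tau+\eta}\right)^k R$.
   Context: Logarithms are natural and applied entrywise to vectors; $\mathbf 1_n$ is the all-ones vector; $\|C\|_\infty=\max_{i,j}|C_{ij}|$. For $u,v\in\mathbb R^n$, $B(u,v)\in\mathbb R^{n\times n}$ is the matrix with entries $B(u,v)_{ij}=\exp\big((u_i+v_j-C_{ij})/\eta\big)$. The dual function is $$h(u,v)=\eta\sum_{i,j=1}^n\exp\Big(\frac{u_i+v_j-C_{ij}}{\eta}\Big)+\tau\sum_{i=1}^n\mathbf a_i e^{-u_i/\tau}+\tau\sum_{j=1}^n\mathbf b_j e^{-v_j/\tau},$$ and $(u^*,v^* )$ denotes its minimizer over $\mathbb R^n\times\mathbb R^n$. The Sinkhorn iterates are defined by $u^0=v^0=0$ and, with $a^k=B(u^k,v^k)\mathbf 1_n$, $b^k=B(u^k,v^k)^\top\mathbf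 1_n$: if $k$ is even, $u^{k+1}=\frac{\eta\tau}{\eta+\tau}\big[\frac{u^k}{\eta}+\log\mathbf a-\log a^k\big]$ and $v^{k+1}=v^k$; if $k$ is odd, $v^{k+1}=\frac{\eta\tau}{\eta+\tau}\big[\frac{v^k}{\eta}+\log\mathbf b-\log b^k\big]$ and $u^{k+1}=u^k$. The constants are $R=\max\{\|\log\mathbf a\|_\infty,\|\log\mathbf b\|_\infty\}+\max\{\log n,\ \tfrac1\eta\|C\|_\infty-\log n\}$, $S=\tfrac12(\alpha+\beta)+\tfrac12+\tfrac{1}{4\log n}$, $T=\tfrac{\alpha+\beta}{2}\big[\log\tfrac{\alpha+\beta}{2}+2\log n-1\big]+\log n+\tfrac52$, $U=\max\{S+T,\ 2\varepsilon,\ \tfrac{4\varepsilon\log n}{\tau},\ \tfrac{4\varepsilon(\alpha+\beta)\log n}{\tau}\}$. *)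

theory Defs
  imports "HOL-Analysis.Analysis"
begin

definition ln_vec :: "real ^ 'n \<Rightarrow> real ^ 'n" where
  "ln_vec x = (\<chi> i. ln (x $ i))"

definition max_entry :: "real ^ 'n ^ 'n \<Rightarrow> real" where
  "max_entry C = Max (range (\<lambda>(i, j). \<bar>C $ i $ j\<bar>))"

definition B_mat :: "real \<Rightarrow> real ^ 'n ^ 'n \<Rightarrow> real ^ 'n \<Rightarrow> real ^ 'n \<Rightarrow> real ^ 'n ^ 'n" where
  "B_mat \<eta> C u v = (\<chi> i j. exp ((u $ i + v $ j - C $ i $ j) / \<eta>))"

definition dual_fun ::
  "real \<Rightarrow> real \<Rightarrow> real ^ 'n ^ 'n \<Rightarrow> real ^ 'n \<Rightarrow> real ^ 'n \<Rightarrow> (real ^ 'n) \<times> (real ^ 'n) \<Rightarrow> real" where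
  "dual_fun \<eta> \<tau> C a b = (\<lambda>(u, v).
     \<eta> * (\<Sum>i\<in>UNIV. \<Sum>j\<in>UNIV. exp ((u $ i + v $ j - C $ i $ j) / \<eta>))
     + \<tau> * (\<Sum>i\<in>UNIV. a $ i * exp (- (u $ i) / \<tau>))
     + \<tau> * (\<Sum>j\<in>UNIV. b $ j * exp (- (v $ j) / \<tau>)))"

(* The vector 1 :: real ^ 'n is the all-ones vector (one_vec_def). *)
primrec sinkhorn ::
  "real \<Rightarrow> real \<Rightarrow> real ^ 'n ^ 'n \<Rightarrow> real ^ 'n \<Rightarrow> real ^ 'n \<Rightarrow> nat \<Rightarrow> (real ^ 'n) \<times> (real ^ 'n)" where
  "sinkhorn \<eta> \<tau> C a b 0 = (0, 0)"
| "sinkhorn \<eta> \<tau> C a b (Suc k) =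
     (let (u, v) = sinkhorn \<eta> \<tau> C a b k;
          ak = B_mat \<eta> C u v *v 1;
          bk = transpose (B_mat \<eta> C u v) *v 1
      in if even k
         then ((\<eta> * \<tau> / (\<eta> + \<tau>)) *\<^sub>R ((1 / \<eta>) *\<^sub>R u + ln_vec a - ln_vec ak), v)
         else (u, (\<eta> * \<tau> / (\<eta> + \<tau>)) *\<^sub>R ((1 / \<eta>) *\<^sub>R v + ln_vec b - ln_vec bk)))"

definition const_R :: "real \<Rightarrow> real ^ 'n ^ 'n \<Rightarrow> real ^ 'n \<Rightarrow> real ^ 'n \<Rightarrow> real" where
  "const_R \<eta> C a b =
     max (infnorm (ln_vec a)) (infnorm (ln_vec b))
     + max (ln (real CARD('n))) (1 / \<eta> * max_entry C - ln (real CARD('n)))"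

definition const_S :: "nat \<Rightarrow> real \<Rightarrow> real \<Rightarrow> real" where
  "const_S n \<alpha> \<beta> = 1 / 2 * (\<alpha> + \<beta>) + 1 / 2 + 1 / (4 * ln (real n))"

definition const_T :: "nat \<Rightarrow> real \<Rightarrow> real \<Rightarrow> real" where
  "const_T n \<alpha> \<beta> =
     (\<alpha> + \<beta>) / 2 * (ln ((\<alpha> + \<beta>) / 2) + 2 * ln (real n) - 1) + ln (real n) + 5 / 2"

definition const_U :: "nat \<Rightarrow> real \<Rightarrow> real \<Rightarrow> real \<Rightarrow> real \<Rightarrow> real" where
  "const_U n \<alpha> \<beta> \<tau> \<epsilon> =
     Max {const_S n \<alpha> \<beta> + const_T n \<alpha> \<beta>, 2 * \<epsilon>, 4 * \<epsilon> * ln (real n) / \<tau>,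
          4 * \<epsilon> * (\<alpha> + \<beta>) * ln (real n) / \<tau>}"

definition sinkhorn_err ::
  "(nat \<Rightarrow> (real ^ 'n) \<times> (real ^ 'n)) \<Rightarrow> (real ^ 'n) \<times> (real ^ 'n) \<Rightarrow> nat \<Rightarrow> real" where
  "sinkhorn_err w ws k =
     max (infnorm (fst (w k) - fst ws)) (infnorm (snd (w k) - snd ws))"

definition Lambda_bound :: "real \<Rightarrow> real \<Rightarrow> real \<Rightarrow> nat \<Rightarrow> real" where
  "Lambda_bound \<tau> \<eta> R k = \<tau> * (\<tau> / (\<tau> + \<eta>)) ^ k * R"

end

theory Submission
  imports Defs
begin

text \<open>
  Eliminating the current value of the updated block, each Sinkhorn step applies the map
  \<open>v \<mapsto> \<eta>\<tau>/(\<eta>+\<tau>) (log a - log \<Sum>\<^sub>j exp ((v\<^sub>j - C\<^sub>i\<^sub>j)/\<eta>))\<close> (or its transposed version), and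
  stationarity of \<open>h\<close> says that the minimizer is a fixed point of both maps. Since log-sum-exp is
  1-Lipschitz in the sup norm, the maps contract with factor \<open>\<tau>/(\<tau>+\<eta>)\<close>, so the errors
  are bounded by powers of this factor times \<open>\<parallel>v\<^sup>*\<parallel>\<close>. The fixed point equations
  also give \<open>(1/\<eta> + 1/\<tau>) M \<le> M/\<eta> + R\<close> for \<open>M = max \<parallel>u\<^sup>*\<parallel> \<parallel>v\<^sup>*\<parallel>\<close>, that is
  \<open>M \<le> \<tau>R\<close>.
\<close>

definition scaling_map ::
  "real \<Rightarrow> real \<Rightarrow> real ^ 'n ^ 'n \<Rightarrow> real ^ 'n \<Rightarrow> real ^ 'n \<Rightarrow> real ^ 'n" where
  "scaling_map \<eta> \<tau> C a v =
     (\<chi> i. \<eta> * \<tau> / (\<eta> + \<tau>) *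
       (ln (a $ i) - ln (\<Sum>j\<in>UNIV. exp ((v $ j - C $ i $ j) / \<eta>))))"

section \<open>Sup-norm estimates for the scaling map\<close>

lemma infnorm_le_cart:
  fixes x :: "real ^ 'n"
  assumes "\<And>i. \<bar>x $ i\<bar> \<le> c"
  shows "infnorm x \<le> c"
  unfolding infnorm_cart by (rule cSup_least) (use assms in auto)

lemma abs_entry_le_max_entry:
  fixes C :: "real ^ 'n ^ 'n"
  shows "\<bar>C $ i $ j\<bar> \<le> max_entry C"
  unfolding max_entry_def by (rule Max_ge) (auto intro!: rev_image_eqI[of "(i, j)"])

lemma max_entry_transpose:
  fixes C :: "real ^ 'n ^ 'n"
  shows "max_entry (transpose C) = max_entry C"
proof -
  have "range (\<lambda>(i, j). \<bar>transpose C $ i $ j\<bar>) = range (\<lambda>(i, j). \<bar>C $ i $ j\<bar>)"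
    by (auto simp: transpose_def image_iff)
  then show ?thesis by (simp add: max_entry_def)
qed

text \<open>Raising every exponent by \<open>d\<close> multiplies the sum by \<open>exp d\<close>.
  Applied in both directions this gives the Lipschitz bound for log-sum-exp; with all exponents on
  one side equal to zero it compares log-sum-exp with \<open>ln (real CARD('n))\<close>.\<close>

lemma ln_sum_exp_mono:
  fixes x y :: "'n::finite \<Rightarrow> real"
  assumes "\<And>j. x j \<le> y j + d"
  shows "ln (\<Sum>j\<in>UNIV. exp (x j)) \<le> ln (\<Sum>j\<in>UNIV. exp (y j)) + d"
proof -
  have px: "(\<Sum>j\<in>UNIV. exp (x j)) > 0" and py: "(\<Sum>j\<in>UNIV. exp (y j)) > 0"
    by (auto intro!: sum_pos)
  have "(\<Sum>j\<in>UNIV. exp (x j)) \<le> (\<Sum>j\<in>UNIV. exp (y j + d))"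
    by (intro sum_mono) (use assms in simp)
  also have "\<dots> = (\<Sum>j\<in>UNIV. exp (y j)) * exp d"
    by (simp add: exp_add sum_distrib_right)
  finally have "ln (\<Sum>j\<in>UNIV. exp (x j)) \<le> ln ((\<Sum>j\<in>UNIV. exp (y j)) * exp d)"
    using px by simp
  also have "\<dots> = ln (\<Sum>j\<in>UNIV. exp (y j)) + d"
    using py by (simp add: ln_mult_pos)
  finally show ?thesis .
qed

text \<open>The \<open>ln (a $ i)\<close> terms cancel, log-sum-exp changes by at most
  \<open>infnorm (v - w) / \<eta>\<close>, and the prefactor of the map turns
  \<open>1 / \<eta>\<close> into \<open>\<tau> / (\<tau> + \<eta>)\<close>.\<close>

lemma scaling_map_contraction:
  fixes C :: "real ^ 'n ^ 'n"
  assumes "\<eta> > 0" "\<tau> > 0"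
  shows "infnorm (scaling_map \<eta> \<tau> C a v - scaling_map \<eta> \<tau> C a w)
           \<le> \<tau> / (\<tau> + \<eta>) * infnorm (v - w)"
proof (rule infnorm_le_cart)
  fix i
  let ?L = "\<lambda>v. ln (\<Sum>j\<in>UNIV. exp ((v $ j - C $ i $ j) / \<eta>))"
  have le: "?L x \<le> ?L y + infnorm (x - y) / \<eta>" for x y :: "real ^ 'n"
  proof (rule ln_sum_exp_mono)
    fix j
    have "x $ j - y $ j \<le> infnorm (x - y)"
      using component_le_infnorm_cart[of "x - y" j] by simp
    then show "(x $ j - C $ i $ j) / \<eta> \<le> (y $ j - C $ i $ j) / \<eta> + infnorm (x - y) / \<eta>"
      using assms by (simp add: field_simps)
  qed
  have "\<bar>?L w - ?L v\<bar> \<le> infnorm (v - w) / \<eta>"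
    using le[of v w] le[of w v] by (simp add: infnorm_sub abs_le_iff)
  then have "\<eta> * \<tau> / (\<eta> + \<tau>) * \<bar>?L w - ?L v\<bar> \<le> \<eta> * \<tau> / (\<eta> + \<tau>) * (infnorm (v - w) / \<eta>)"
    using assms by (intro mult_left_mono) auto
  moreover have "(scaling_map \<eta> \<tau> C a v - scaling_map \<eta> \<tau> C a w) $ i
      = \<eta> * \<tau> / (\<eta> + \<tau>) * (?L w - ?L v)"
    by (simp add: scaling_map_def right_diff_distrib)
  ultimately show "\<bar>(scaling_map \<eta> \<tau> C a v - scaling_map \<eta> \<tau> C a w) $ i\<bar>
      \<le> \<tau> / (\<tau> + \<eta>) * infnorm (v - w)"
    using assms by (simp add: abs_mult add.commute)
qed

text \<open>Log-sum-exp is compared with the case of zero exponents. From above, nonnegative costs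
  leave an excess of only \<open>infnorm v / \<eta>\<close>; from below,
  \<open>max_entry C / \<eta>\<close> is lost as well. The two signs of
  \<open>ln (a $ i) - ?L\<close> thus produce the two arguments of \<open>max\<close>.\<close>

lemma infnorm_scaling_map_le:
  fixes C :: "real ^ 'n ^ 'n"
  assumes "\<eta> > 0" "\<tau> > 0" "\<And>i j. C $ i $ j \<ge> 0"
  shows "infnorm (scaling_map \<eta> \<tau> C a v) \<le> \<eta> * \<tau> / (\<eta> + \<tau>) *
    (infnorm v / \<eta> + infnorm (ln_vec a)
      + max (ln (real CARD('n))) (1 / \<eta> * max_entry C - ln (real CARD('n))))"
proof (rule infnorm_le_cart)
  fix i
  let ?N = "ln (real CARD('n))"
  let ?L = "ln (\<Sum>j\<in>UNIV. exp ((v $ j - C $ i $ j) / \<eta>))"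
  have "?L \<le> ln (\<Sum>j\<in>(UNIV::'n set). exp 0) + infnorm v / \<eta>"
  proof (rule ln_sum_exp_mono)
    fix j
    show "(v $ j - C $ i $ j) / \<eta> \<le> 0 + infnorm v / \<eta>"
      using component_le_infnorm_cart[of v j] assms(1) assms(3)[of i j]
      by (simp add: divide_right_mono)
  qed
  moreover have "ln (\<Sum>j\<in>(UNIV::'n set). exp 0) \<le> ?L + (infnorm v + max_entry C) / \<eta>"
  proof (rule ln_sum_exp_mono)
    fix j
    have "0 \<le> (v $ j - C $ i $ j) + (infnorm v + max_entry C)"
      using component_le_infnorm_cart[of v j] abs_entry_le_max_entry[of C i j] by linarith
    then have "0 \<le> ((v $ j - C $ i $ j) + (infnorm v + max_entry C)) / \<eta>"
      using assms(1) by simp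
    then show "0 \<le> (v $ j - C $ i $ j) / \<eta> + (infnorm v + max_entry C) / \<eta>"
      by (simp only: add_divide_distrib)
  qed
  moreover have "\<bar>ln (a $ i)\<bar> \<le> infnorm (ln_vec a)"
    using component_le_infnorm_cart[of "ln_vec a" i] by (simp add: ln_vec_def)
  ultimately have "\<bar>ln (a $ i) - ?L\<bar>
      \<le> infnorm v / \<eta> + infnorm (ln_vec a) + max ?N (1 / \<eta> * max_entry C - ?N)"
    by (simp add: add_divide_distrib)
  then have "\<eta> * \<tau> / (\<eta> + \<tau>) * \<bar>ln (a $ i) - ?L\<bar> \<le> \<eta> * \<tau> / (\<eta> + \<tau>) *
      (infnorm v / \<eta> + infnorm (ln_vec a) + max ?N (1 / \<eta> * max_entry C - ?N))"
    using assms by (intro mult_left_mono) auto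
  then show "\<bar>scaling_map \<eta> \<tau> C a v $ i\<bar> \<le> \<eta> * \<tau> / (\<eta> + \<tau>) *
      (infnorm v / \<eta> + infnorm (ln_vec a) + max ?N (1 / \<eta> * max_entry C - ?N))"
    using assms by (simp add: scaling_map_def abs_mult)
qed

lemma fixed_point_infnorm_le:
  fixes C :: "real ^ 'n ^ 'n"
  assumes "\<eta> > 0" "\<tau> > 0" "\<And>i j. C $ i $ j \<ge> 0"
    and u: "u = scaling_map \<eta> \<tau> C a v" and v: "v = scaling_map \<eta> \<tau> (transpose C) b u"
  shows "max (infnorm u) (infnorm v) \<le> \<tau> * const_R \<eta> C a b"
proof -
  let ?M = "max (infnorm u) (infnorm v)" and ?R = "const_R \<eta> C a b"
  let ?K = "max (ln (real CARD('n))) (1 / \<eta> * max_entry C - ln (real CARD('n)))"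
  have c: "0 \<le> \<eta> * \<tau> / (\<eta> + \<tau>)" using assms by simp
  have "infnorm v / \<eta> \<le> ?M / \<eta>" "infnorm u / \<eta> \<le> ?M / \<eta>"
    using assms(1) by (auto intro: divide_right_mono)
  then have
    "infnorm v / \<eta> + infnorm (ln_vec a) + ?K \<le> ?M / \<eta> + ?R"
    "infnorm u / \<eta> + infnorm (ln_vec b) + ?K \<le> ?M / \<eta> + ?R"
    unfolding const_R_def by linarith+
  note mult_left_mono[OF this(1) c] mult_left_mono[OF this(2) c]
  moreover have "infnorm u \<le> \<eta> * \<tau> / (\<eta> + \<tau>) * (infnorm v / \<eta> + infnorm (ln_vec a) + ?K)"
    using infnorm_scaling_map_le[of \<eta> \<tau> C a v] assms(1-3) u by simp
  moreover have "infnorm v \<le> \<eta> * \<tau> / (\<eta> + \<tau>) * (infnorm u / \<eta> + infnorm (ln_vec b) + ?K)"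
    using infnorm_scaling_map_le[of \<eta> \<tau> "transpose C" b u] assms(1-3) v
    by (simp add: max_entry_transpose) (simp add: transpose_def)
  \<comment> \<open>Each block is bounded through the other, so their maximum is bounded through
    itself. On the right \<open>?M\<close> has coefficient
    \<open>\<tau> / (\<eta> + \<tau>)\<close>, below 1; after clearing the denominator
    \<open>\<tau> * ?M\<close> cancels and \<open>\<eta> * ?M\<close> remains.\<close>
  ultimately have "?M \<le> \<eta> * \<tau> / (\<eta> + \<tau>) * (?M / \<eta> + ?R)"
    by linarith
  then have "(\<eta> + \<tau>) * ?M \<le> (\<eta> + \<tau>) * (\<eta> * \<tau> / (\<eta> + \<tau>) * (?M / \<eta> + ?R))"
    using assms(1,2) by (intro mult_left_mono) auto
  also have "\<dots> = \<eta> * \<tau> * (?M / \<eta> + ?R)"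
    using assms(1,2) by simp
  also have "\<dots> = \<tau> * ?M + \<eta> * (\<tau> * ?R)"
    using assms(1) by (simp add: algebra_simps)
  finally have "\<eta> * ?M \<le> \<eta> * (\<tau> * ?R)" by (simp add: algebra_simps)
  then show ?thesis using assms(1) by simp
qed

section \<open>Stationarity of the dual function\<close>

lemma exp_balance_if_min_at_zero:
  fixes A D :: real
  assumes "\<eta> > 0" "\<tau> > 0"
    and "\<And>t. 0 \<le> \<eta> * A * (exp (t / \<eta>) - 1) + \<tau> * D * (exp (- t / \<tau>) - 1)"
  shows "A = D"
proof -
  let ?f = "\<lambda>t. \<eta> * A * (exp (t / \<eta>) - 1) + \<tau> * D * (exp (- t / \<tau>) - 1)"
  \<comment> \<open>Since \<open>?f 0 = 0\<close>, nonnegativity makes 0 a global minimum, so the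
    derivative there must vanish; any radius \<open>d\<close> serves below.\<close>
  have "(?f has_real_derivative A - D) (at 0)"
    using assms(1,2) by (auto intro!: derivative_eq_intros)
  then have "A - D = 0"
    by (rule DERIV_local_min[where d = 1]) (use assms(3) in auto)
  then show ?thesis by simp
qed

text \<open>Only the \<open>i\<close>-th row sum and the \<open>i\<close>-th marginal term change,
  each by an exponential factor in \<open>t\<close>. The exact increment has the shape handled by
  \<open>exp_balance_if_min_at_zero\<close>, which reduces stationarity to one variable.\<close>

lemma dual_fun_shift_coordinate:
  fixes C :: "real ^ 'n ^ 'n"
  shows "dual_fun \<eta> \<tau> C a b (u + axis i t, v) = dual_fun \<eta> \<tau> C a b (u, v)
    + \<eta> * (\<Sum>j\<in>UNIV. exp ((u $ i + v $ j - C $ i $ j) / \<eta>)) * (exp (t / \<eta>) - 1)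
    + \<tau> * (a $ i * exp (- (u $ i) / \<tau>)) * (exp (- t / \<tau>) - 1)"
proof -
  let ?r = "\<lambda>u i. (\<Sum>j\<in>UNIV. exp ((u $ i + v $ j - C $ i $ j) / \<eta>))"
  let ?s = "\<lambda>u i. a $ i * exp (- (u $ i) / \<tau>)"
  have r: "?r (u + axis i t) k = ?r u k + (if k = i then ?r u i * (exp (t / \<eta>) - 1) else 0)" for k
  proof -
    have "?r (u + axis i t) i = ?r u i * exp (t / \<eta>)"
      unfolding sum_distrib_right exp_add[symmetric] add_divide_distrib[symmetric]
      by (simp add: axis_def algebra_simps)
    then show ?thesis by (simp add: axis_def right_diff_distrib)
  qed
  have s: "?s (u + axis i t) k = ?s u k + (if k = i then ?s u i * (exp (- t / \<tau>) - 1) else 0)" for k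
  proof -
    have "?s (u + axis i t) i = ?s u i * exp (- t / \<tau>)"
      unfolding mult.assoc exp_add[symmetric] add_divide_distrib[symmetric]
      by (simp add: axis_def)
    then show ?thesis by (simp add: axis_def right_diff_distrib)
  qed
  show ?thesis
    unfolding dual_fun_def prod.case r s sum.distrib sum.delta[OF finite]
    by (simp only: UNIV_I if_True distrib_left add_ac mult.assoc)
qed

text \<open>This symmetry transfers results on the first block to the second one.\<close>

lemma dual_fun_transpose:
  fixes C :: "real ^ 'n ^ 'n"
  shows "dual_fun \<eta> \<tau> (transpose C) b a (v, u) = dual_fun \<eta> \<tau> C a b (u, v)"
proof -
  have "(\<Sum>i\<in>UNIV. \<Sum>j\<in>UNIV. exp ((v $ i + u $ j - C $ j $ i) / \<eta>))
      = (\<Sum>i\<in>UNIV. \<Sum>j\<in>UNIV. exp ((u $ i + v $ j - C $ i $ j) / \<eta>))"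
    by (subst sum.swap) (simp add: add.commute)
  then show ?thesis by (simp add: dual_fun_def transpose_def)
qed

lemma minimizer_eq_scaling_map:
  fixes C :: "real ^ 'n ^ 'n"
  assumes "\<eta> > 0" "\<tau> > 0" "\<And>i. a $ i > 0"
    and min: "\<And>u'. dual_fun \<eta> \<tau> C a b (u, v) \<le> dual_fun \<eta> \<tau> C a b (u', v)"
  shows "u = scaling_map \<eta> \<tau> C a v"
proof (subst vec_eq_iff, intro allI)
  fix i
  let ?S = "\<Sum>j\<in>UNIV. exp ((v $ j - C $ i $ j) / \<eta>)"
  have S: "?S > 0" by (auto intro!: sum_pos)
  \<comment> \<open>First-order condition for the single coordinate \<open>u $ i\<close>.\<close>
  have "(\<Sum>j\<in>UNIV. exp ((u $ i + v $ j - C $ i $ j) / \<eta>)) = a $ i * exp (- (u $ i) / \<tau>)"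
  proof (rule exp_balance_if_min_at_zero[OF assms(1,2)])
    fix t
    show "0 \<le> \<eta> * (\<Sum>j\<in>UNIV. exp ((u $ i + v $ j - C $ i $ j) / \<eta>)) * (exp (t / \<eta>) - 1)
        + \<tau> * (a $ i * exp (- (u $ i) / \<tau>)) * (exp (- t / \<tau>) - 1)"
      using min[of "u + axis i t"] unfolding dual_fun_shift_coordinate by linarith
  qed
  moreover have "(\<Sum>j\<in>UNIV. exp ((u $ i + v $ j - C $ i $ j) / \<eta>)) = exp (u $ i / \<eta>) * ?S"
    by (simp add: sum_distrib_left exp_add[symmetric] add_divide_distrib diff_divide_distrib
        algebra_simps)
  \<comment> \<open>Logarithms make the condition linear in \<open>u $ i\<close>, with coefficient
    \<open>1 / \<eta> + 1 / \<tau>\<close>, the reciprocal of the prefactor of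
    \<open>scaling_map\<close>.\<close>
  ultimately have "ln (exp (u $ i / \<eta>) * ?S) = ln (a $ i * exp (- (u $ i) / \<tau>))"
    by simp
  then have "u $ i / \<eta> + ln ?S = ln (a $ i) - u $ i / \<tau>"
    using S assms(3)[of i] by (simp add: ln_mult_pos)
  then have "\<eta> * \<tau> / (\<eta> + \<tau>) * (ln (a $ i) - ln ?S) = \<eta> * \<tau> / (\<eta> + \<tau>) * (u $ i / \<eta> + u $ i / \<tau>)"
    by simp
  also have "u $ i / \<eta> + u $ i / \<tau> = u $ i * ((\<eta> + \<tau>) / (\<eta> * \<tau>))"
    using assms(1,2) by (simp add: field_simps)
  finally show "u $ i = scaling_map \<eta> \<tau> C a v $ i"
    using assms(1,2) by (simp add: scaling_map_def)
qed

section \<open>Sinkhorn steps as applications of the scaling map\<close>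

lemma sinkhorn_update_eq_scaling_map:
  fixes C :: "real ^ 'n ^ 'n"
  shows "(\<eta> * \<tau> / (\<eta> + \<tau>)) *\<^sub>R ((1 / \<eta>) *\<^sub>R u + ln_vec a - ln_vec (B_mat \<eta> C u v *v 1))
    = scaling_map \<eta> \<tau> C a v"
proof -
  have "ln ((B_mat \<eta> C u v *v 1) $ i)
      = u $ i / \<eta> + ln (\<Sum>j\<in>UNIV. exp ((v $ j - C $ i $ j) / \<eta>))" for i
  proof -
    have "(\<Sum>j\<in>UNIV. exp ((v $ j - C $ i $ j) / \<eta>)) > 0" by (auto intro!: sum_pos)
    \<comment> \<open>The old value of the updated block factors out of the row sum; its logarithm
      then cancels the term \<open>u / \<eta>\<close> of the update.\<close>
    moreover have "(B_mat \<eta> C u v *v 1) $ i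
        = exp (u $ i / \<eta>) * (\<Sum>j\<in>UNIV. exp ((v $ j - C $ i $ j) / \<eta>))"
      by (simp add: matrix_vector_mult_def B_mat_def sum_distrib_left exp_add[symmetric]
          add_divide_distrib diff_divide_distrib algebra_simps)
    ultimately show ?thesis by (simp add: ln_mult_pos)
  qed
  then show ?thesis
    by (simp add: vec_eq_iff scaling_map_def ln_vec_def)
qed

text \<open>Makes an odd step an even step for the transposed costs with the blocks
  exchanged.\<close>

lemma transpose_B_mat: "transpose (B_mat \<eta> C u v) = B_mat \<eta> (transpose C) v u"
  by (simp add: B_mat_def transpose_def vec_eq_iff add.commute)

lemma sinkhorn_Suc_scaling_map:
  fixes C :: "real ^ 'n ^ 'n"
  shows "sinkhorn \<eta> \<tau> C a b (Suc k) =
    (if even k then (scaling_map \<eta> \<tau> C a (snd (sinkhorn \<eta> \<tau> C a b k)), snd (sinkhorn \<eta> \<tau> C a b k))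
     else (fst (sinkhorn \<eta> \<tau> C a b k),
           scaling_map \<eta> \<tau> (transpose C) b (fst (sinkhorn \<eta> \<tau> C a b k))))"
  by (simp add: Let_def case_prod_beta transpose_B_mat sinkhorn_update_eq_scaling_map)

text \<open>The block updated last is one contraction step ahead of the other one.\<close>

lemma sinkhorn_block_errors:
  fixes C :: "real ^ 'n ^ 'n"
  assumes "\<eta> > 0" "\<tau> > 0"
    and u: "u = scaling_map \<eta> \<tau> C a v" and v: "v = scaling_map \<eta> \<tau> (transpose C) b u"
  defines "\<rho> \<equiv> \<tau> / (\<tau> + \<eta>)"
  shows "infnorm (fst (sinkhorn \<eta> \<tau> C a b (Suc k)) - u)
           \<le> \<rho> ^ (if even k then Suc k else k) * infnorm v
       \<and> infnorm (snd (sinkhorn \<eta> \<tau> C a b (Suc k)) - v)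
           \<le> \<rho> ^ (if even k then k else Suc k) * infnorm v"
proof -
  have \<rho>: "0 \<le> \<rho>" using assms by (simp add: \<rho>_def)
  have U: "infnorm (scaling_map \<eta> \<tau> C a x - u) \<le> \<rho> * infnorm (x - v)" for x
    using scaling_map_contraction[OF assms(1,2), of C a x v] u by (simp add: \<rho>_def)
  have V: "infnorm (scaling_map \<eta> \<tau> (transpose C) b x - v) \<le> \<rho> * infnorm (x - u)" for x
    using scaling_map_contraction[OF assms(1,2), of "transpose C" b x u] v by (simp add: \<rho>_def)
  show ?thesis
  proof (induction k)
    \<comment> \<open>The induction starts after the first step: that step replaces \<open>u\<close>
      using only the initial \<open>v = 0\<close>, whose error is \<open>infnorm v\<close>, so the
      initial error of \<open>u\<close> never enters.\<close>
    case 0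
    show ?case
      using U[of 0] by (simp add: sinkhorn_Suc_scaling_map infnorm_neg del: sinkhorn.simps(2))
  next
    case (Suc k)
    let ?w = "sinkhorn \<eta> \<tau> C a b (Suc k)"
    show ?case
    proof (cases "even k")
      case True
      \<comment> \<open>The next step keeps the fresh block \<open>u\<close> and recomputes
        \<open>v\<close> from it. The bound on \<open>u\<close> therefore persists and, multiplied
        by \<open>\<rho>\<close>, bounds the new \<open>v\<close>; the error of the old
        \<open>v\<close> is discarded.\<close>
      have "infnorm (fst ?w - u) \<le> \<rho> ^ Suc k * infnorm v" using Suc True by simp
      from mult_left_mono[OF this \<rho>] this show ?thesis
        using V[of "fst ?w"] True
        by (simp add: sinkhorn_Suc_scaling_map[of _ _ _ _ _ "Suc k"] mult.assoc
            del: sinkhorn.simps(2))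
    next
      case False
      have "infnorm (snd ?w - v) \<le> \<rho> ^ Suc k * infnorm v" using Suc False by simp
      from mult_left_mono[OF this \<rho>] this show ?thesis
        using U[of "snd ?w"] False
        by (simp add: sinkhorn_Suc_scaling_map[of _ _ _ _ _ "Suc k"] mult.assoc
            del: sinkhorn.simps(2))
    qed
  qed
qed

theorem theorem1:
  fixes a b us vs :: "real ^ 'n" and C :: "real ^ 'n ^ 'n"
    and \<alpha> \<beta> \<tau> \<epsilon> \<eta> :: real and k :: nat
  assumes "CARD('n) \<ge> 2"
    and "\<And>i. a $ i > 0"
    and "\<And>j. b $ j > 0"
    and "\<alpha> = (\<Sum>i\<in>UNIV. a $ i)"
    and "\<beta> = (\<Sum>j\<in>UNIV. b $ j)"
    and "\<And>i j. C $ i $ j \<ge> 0"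
    and "\<tau> > 0"
    and "\<epsilon> > 0"
    and "\<eta> = \<epsilon> / const_U CARD('n) \<alpha> \<beta> \<tau> \<epsilon>"
    and "is_arg_min (dual_fun \<eta> \<tau> C a b) (\<lambda>_. True) (us, vs)"
  shows "sinkhorn_err (sinkhorn \<eta> \<tau> C a b) (us, vs) (k + 1)
           \<le> Lambda_bound \<tau> \<eta> (const_R \<eta> C a b) k"
proof -
  \<comment> \<open>The entry \<open>2 * \<epsilon>\<close> of the maximum makes the denominator of
    \<open>\<eta>\<close> positive.\<close>
  have "2 * \<epsilon> \<le> const_U CARD('n) \<alpha> \<beta> \<tau> \<epsilon>"
    unfolding const_U_def by (rule Max_ge) auto
  then have \<eta>: "\<eta> > 0" using assms(8,9) by simp
  have min: "dual_fun \<eta> \<tau> C a b (us, vs) \<le> dual_fun \<eta> \<tau> C a b w" for w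
    using assms(10) by (cases w) (simp add: is_arg_min_linorder)
  have us: "us = scaling_map \<eta> \<tau> C a vs"
    by (rule minimizer_eq_scaling_map[where b = b]) (use \<eta> assms(2,7) min in auto)
  have vs: "vs = scaling_map \<eta> \<tau> (transpose C) b us"
    by (rule minimizer_eq_scaling_map[where b = a])
      (use \<eta> assms(3,7) min in \<open>auto simp: dual_fun_transpose\<close>)
  define \<rho> where "\<rho> = \<tau> / (\<tau> + \<eta>)"
  have \<rho>: "0 \<le> \<rho>" "\<rho> \<le> 1" using \<eta> assms(7) by (auto simp: \<rho>_def)
  \<comment> \<open>After \<open>k + 1\<close> steps the fresh block has the factor
    \<open>\<rho> ^ Suc k\<close>, the lagging one only \<open>\<rho> ^ k\<close>; the larger factor
    bounds both, hence the exponent \<open>k\<close> for iterate \<open>k + 1\<close>.\<close>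
  have "\<rho> ^ Suc k * infnorm vs \<le> \<rho> ^ k * infnorm vs"
    using \<rho> by (intro mult_right_mono power_decreasing) (auto simp: infnorm_pos_le)
  then have "sinkhorn_err (sinkhorn \<eta> \<tau> C a b) (us, vs) (k + 1) \<le> \<rho> ^ k * infnorm vs"
    using sinkhorn_block_errors[OF \<eta> assms(7) us vs, of k]
    by (auto simp: sinkhorn_err_def \<rho>_def simp del: sinkhorn.simps(2) power_Suc
        split: if_splits)
  also have "\<dots> \<le> \<rho> ^ k * (\<tau> * const_R \<eta> C a b)"
    using fixed_point_infnorm_le[OF \<eta> assms(7,6) us vs] \<rho>
    by (intro mult_left_mono) auto
  finally show ?thesis
    by (simp add: Lambda_bound_def \<rho>_def mult_ac)
qed

end
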